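(* Let $c_2(n)$ be defined by $\frac{1}{\Psi(-q^2,q)} = \sum_{n=0}^\infty c_2(n) q^n$. Then the coefficients $c_2(n)$ grow exponentially with base $b$ in the interval $1.53623 < b < 1.54522$.
   Context: The false theta function is the formal power series in $q$ (for $x,y$ equal to signed powers of $q$) given by $$\Psi(x,y) := \sum_{n=0}^\infty x^{\binom{n+1}{2}} y^{\binom{n}{2}} - \sum_{n=-\infty}^{-1} x^{\binom{n+1}{2}} y^{\binom{n}{2}},$$ where for every integer $n$, $\binom{n+1}{2} = n(n+1)/2$ and $\binom{n}{2} = n(n-1)/2$. Thus $\Psi(-q^2,q) = 1 - q - q^2 + q^5 - q^7 + q^{12} + q^{15} - q^{22} + q^{26} - \cdots$, which has constant term $1$, so its reciprocal is a power series with integer coefficients. *)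

theory Defs
  imports
    "HOL-Analysis.Analysis"
    "HOL-Computational_Algebra.Formal_Power_Series"
    "HOL-Library.Landau_Symbols"
begin

text \<open>
  The exponents \<open>n * (n + 1) / 2\<close> and \<open>n * (n - 1) / 2\<close> are nonnegative integers for every integer
  \<open>n\<close>, so the conversion to \<^typ>\<open>nat\<close> loses nothing. The infinite sums are taken in the usual
  (\<open>X\<close>-adic) topology on formal power series; they converge whenever the constant terms of \<open>x\<close> and
  \<open>y\<close> vanish (see \<open>false_theta_summable\<close> below).
\<close>

definition binom2 :: "int \<Rightarrow> nat" where
  "binom2 n = nat (n * (n - 1) div 2)"

definition false_theta :: "'a::comm_ring_1 fps \<Rightarrow> 'a fps \<Rightarrow> 'a fps" where
  "false_theta x y =
     (\<Sum>\<^sub>\<infinity>n\<in>{0..}. x ^ binom2 (n + 1) * y ^ binom2 n)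
   - (\<Sum>\<^sub>\<infinity>n\<in>{..<0}. x ^ binom2 (n + 1) * y ^ binom2 n)"

definition c2 :: "nat \<Rightarrow> real" where
  "c2 n = fps_nth (1 / false_theta (- (fps_X ^ 2)) fps_X) n"

lemma fps_has_sum:
  fixes f :: "'i \<Rightarrow> 'a::comm_ring_1 fps"
  assumes fin: "\<And>k. finite {i \<in> A. fps_nth (f i) k \<noteq> 0}"
  shows "(f has_sum Abs_fps (\<lambda>k. \<Sum>i | i \<in> A \<and> fps_nth (f i) k \<noteq> 0. fps_nth (f i) k)) A"
  unfolding has_sum_def
proof (rule tendsto_fpsI)
  fix k
  let ?S = "{i \<in> A. fps_nth (f i) k \<noteq> 0}"
  show "eventually (\<lambda>F. fps_nth (sum f F) k
          = fps_nth (Abs_fps (\<lambda>k. \<Sum>i | i \<in> A \<and> fps_nth (f i) k \<noteq> 0. fps_nth (f i) k)) k)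
          (finite_subsets_at_top A)"
    unfolding eventually_finite_subsets_at_top
  proof (intro exI[of _ ?S] conjI allI impI)
    fix F assume F: "finite F \<and> ?S \<subseteq> F \<and> F \<subseteq> A"
    have "(\<Sum>i\<in>?S. fps_nth (f i) k) = (\<Sum>i\<in>F. fps_nth (f i) k)"
      by (rule sum.mono_neutral_left) (use F in auto)
    then show "fps_nth (sum f F) k
        = fps_nth (Abs_fps (\<lambda>k. \<Sum>i | i \<in> A \<and> fps_nth (f i) k \<noteq> 0. fps_nth (f i) k)) k"
      by (simp add: fps_sum_nth)
  qed (use fin in auto)
qed

lemma binom2_ge: "n * (n - 1) \<le> 2 * int (binom2 n) + 1"
  unfolding binom2_def by auto

lemma false_theta_summable:
  fixes x y :: "'a::comm_ring_1 fps"
  assumes x: "fps_nth x 0 = 0" and y: "fps_nth y 0 = 0"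
  shows "(\<lambda>n. x ^ binom2 (n + 1) * y ^ binom2 n) summable_on A"
proof (rule has_sum_imp_summable, rule fps_has_sum)
  fix k
  let ?f = "\<lambda>n. x ^ binom2 (n + 1) * y ^ binom2 n"
  have "n \<in> {- int k - 1..int k + 1}" if nz: "fps_nth (?f n) k \<noteq> 0" for n
  proof -
    have "\<exists>i\<in>{0..k}. fps_nth (x ^ binom2 (n + 1)) i * fps_nth (y ^ binom2 n) (k - i) \<noteq> 0"
    proof (rule ccontr)
      assume "\<not> ?thesis"
      then have "fps_nth (?f n) k = 0"
        unfolding fps_mult_nth by (intro sum.neutral) blast
      with nz show False by contradiction
    qed
    then obtain i where "i \<le> k" and i: "fps_nth (x ^ binom2 (n + 1)) i \<noteq> 0"
        "fps_nth (y ^ binom2 n) (k - i) \<noteq> 0"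
      by (metis atLeastAtMost_iff mult_zero_left mult_zero_right)
    have "binom2 (n + 1) \<le> i"
      using i(1) startsby_zero_power_prefix[OF x] by (meson not_le)
    moreover have "binom2 n \<le> k - i"
      using i(2) startsby_zero_power_prefix[OF y] by (meson not_le)
    ultimately have "binom2 (n + 1) + binom2 n \<le> k"
      using \<open>i \<le> k\<close> by linarith
    then have "n * (n - 1) + (n + 1) * n \<le> 2 * int k + 2"
      using binom2_ge[of n] binom2_ge[of "n + 1"] by simp
    then have n2: "n * n \<le> int k + 1" by (simp add: algebra_simps)
    have "\<bar>n\<bar> * 1 \<le> \<bar>n\<bar> * \<bar>n\<bar>"
      by (cases "n = 0") (simp, rule mult_left_mono, auto)
    with n2 have "\<bar>n\<bar> \<le> int k + 1" by (simp only: abs_mult_self_eq mult_1_right)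
    then show ?thesis by (simp add: abs_le_iff)
  qed
  then show "finite {n \<in> A. fps_nth (?f n) k \<noteq> 0}"
    by (intro finite_subset[OF _ finite_atLeastAtMost_int[of "- int k - 1" "int k + 1"]]) auto
qed

end

theory Submission
  imports Defs
begin

text \<open>
  Writing \<open>t(n) = n(n+1)/2\<close>, the series is \<open>f(q) = \<Sum>n. (-1)^t(n) (q^(3t(n)-n) - q^(3t(n)+n+1))\<close>.
  Truncating at \<open>q^40\<close> locates a root \<open>r\<close> of \<open>f\<close> just below \<open>1 / 1.53623\<close>. Then
  \<open>f(r X) = (1 - X) S(X)\<close>, where the coefficients of \<open>S\<close> are the partial sums of \<open>f(r)\<close>.
  These start with 1, and the absolute values of the others add up to less than 1. Hence
  \<open>1 / S\<close> has absolutely summable coefficients, and \<open>c\<^sub>2(n) r^n\<close>, being their partial sums,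
  tends to \<open>1 / S(1) > 0\<close>.
\<close>

unbundle no vec_syntax
unbundle fps_syntax

section \<open>Reciprocals of real power series and tail bounds\<close>

text \<open>Comparing coefficients in \<open>s * H = 1\<close> bounds each
  \<open>\<bar>H $ Suc k\<bar>\<close> by a convolution. So the partial sums A(n) of the
  \<open>\<bar>H $ k\<bar>\<close> satisfy A(n+1) \<le> 1 + q A(n) and stay below the fixed point
  1/(1-q).\<close>

lemma summable_fps_inverse:
  fixes s :: "real fps"
  assumes s0: "s $ 0 = 1"
    and sm: "summable (\<lambda>n. \<bar>s $ Suc n\<bar>)" and less1: "(\<Sum>n. \<bar>s $ Suc n\<bar>) < 1"
  shows "summable (\<lambda>n. \<bar>inverse s $ n\<bar>)"
proof -
  define H where "H = inverse s"
  define q where "q = (\<Sum>n. \<bar>s $ Suc n\<bar>)"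
  have q0: "0 \<le> q" unfolding q_def by (intro suminf_nonneg sm) auto
  have q1: "q < 1" using less1 by (simp add: q_def)
  have sH: "s * H = 1"
    unfolding H_def using s0 by (simp add: inverse_mult_eq_1')
  have H0: "H $ 0 = 1" using s0 by (simp add: H_def)
  have step: "\<bar>H $ Suc k\<bar> \<le> (\<Sum>i\<le>k. \<bar>s $ Suc i\<bar> * \<bar>H $ (k - i)\<bar>)" for k
  proof -
    have "0 = (s * H) $ Suc k" by (simp add: sH)
    also have "\<dots> = H $ Suc k + (\<Sum>i\<le>k. s $ Suc i * H $ (k - i))"
      using s0 by (simp add: fps_mult_nth atLeast0AtMost sum.atMost_Suc_shift del: sum.atMost_Suc)
    finally have "H $ Suc k = - (\<Sum>i\<le>k. s $ Suc i * H $ (k - i))" by simp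
    then show ?thesis
      by (simp only: abs_minus_cancel abs_mult[symmetric] sum_abs)
  qed
  have bound: "(\<Sum>k<n. \<bar>H $ k\<bar>) \<le> 1 / (1 - q)" for n
  proof (induction n)
    case 0
    then show ?case using q1 by simp
  next
    case (Suc n)
    have "(\<Sum>k<Suc n. \<bar>H $ k\<bar>) = 1 + (\<Sum>k<n. \<bar>H $ Suc k\<bar>)"
      by (simp add: sum.lessThan_Suc_shift H0 del: sum.lessThan_Suc)
    also have "(\<Sum>k<n. \<bar>H $ Suc k\<bar>) \<le> (\<Sum>k<n. \<Sum>i\<le>k. \<bar>s $ Suc i\<bar> * \<bar>H $ (k - i)\<bar>)"
      by (intro sum_mono step)
    also have "\<dots> = (\<Sum>(i,j)\<in>{(i,j). i + j < n}. \<bar>s $ Suc i\<bar> * \<bar>H $ j\<bar>)"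
      by (rule sum.triangle_reindex[symmetric])
    \<comment> \<open>Enlarging the triangle to a square makes the double sum factor.\<close>
    also have "\<dots> \<le> (\<Sum>(i,j)\<in>{..<n} \<times> {..<n}. \<bar>s $ Suc i\<bar> * \<bar>H $ j\<bar>)"
      by (intro sum_mono2) auto
    also have "\<dots> = (\<Sum>i<n. \<bar>s $ Suc i\<bar>) * (\<Sum>j<n. \<bar>H $ j\<bar>)"
      by (simp only: sum_product sum.cartesian_product)
    also have "\<dots> \<le> q * (1 / (1 - q))"
      by (intro mult_mono Suc.IH q0 sum_nonneg)
         (auto simp: q_def intro!: sum_le_suminf sm)
    also have "1 + q * (1 / (1 - q)) = 1 / (1 - q)"
      using q1 by (simp add: field_simps)
    finally show ?case by simp
  qed
  show ?thesis
    unfolding H_def[symmetric] by (rule summableI_nonneg_bounded[OF _ bound]) auto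
qed

text \<open>Summability forces \<open>s\<close> to tend to 0, so the hypotheses already make
  \<open>r\<close> a root of \<open>f\<close>. The limit is the value at 1 of the reciprocal of the
  cofactor left after the zero is split off.\<close>

lemma fps_inverse_nth_asymp:
  fixes f :: "real fps" and r :: real
  defines "s \<equiv> \<lambda>n. \<Sum>k\<le>n. f $ k * r ^ k"
  assumes f0: "f $ 0 = 1"
    and sm: "summable (\<lambda>n. \<bar>s (Suc n)\<bar>)" and less1: "(\<Sum>n. \<bar>s (Suc n)\<bar>) < 1"
  shows "\<exists>C>0. (\<lambda>n. inverse f $ n * r ^ n) \<longlonglongrightarrow> C"
proof -
  define S where "S = Abs_fps s"
  define H where "H = inverse S"
  define F where "F = Abs_fps (\<lambda>n. f $ n * r ^ n)"
  define D where "D = Abs_fps (\<lambda>n. inverse f $ n * r ^ n)"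
  have S0: "S $ 0 = 1" by (simp add: S_def s_def f0)
  have FD: "F * D = 1"
  proof (rule fps_ext)
    fix n
    have "(F * D) $ n = (\<Sum>i=0..n. f $ i * inverse f $ (n - i)) * r ^ n"
      unfolding fps_mult_nth F_def D_def sum_distrib_right
      by (intro sum.cong refl) (simp add: power_add[symmetric] mult_ac)
    also have "(\<Sum>i=0..n. f $ i * inverse f $ (n - i)) = (f * inverse f) $ n"
      by (simp add: fps_mult_nth)
    also have "f * inverse f = 1"
      using f0 by (simp add: inverse_mult_eq_1')
    finally show "(F * D) $ n = 1 $ n" by simp
  qed
  have F: "F = (1 - fps_X) * S"
  proof (rule fps_ext)
    fix n show "F $ n = ((1 - fps_X) * S) $ n"
      by (cases n) (simp_all add: F_def S_def s_def left_diff_distrib)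
  qed
  have "S * ((1 - fps_X) * D) = 1" using FD F by (simp add: mult_ac)
  then have H: "H = (1 - fps_X) * D"
    unfolding H_def by (rule fps_inverse_unique)
  \<comment> \<open>Dividing by \<open>1 - fps_X\<close> means taking partial sums of
    coefficients.\<close>
  have D: "D $ n = (\<Sum>k<Suc n. H $ k)" for n
  proof (induction n)
    case (Suc n)
    then show ?case by (simp add: H left_diff_distrib)
  qed (simp add: H left_diff_distrib)
  have smH: "summable (\<lambda>n. \<bar>H $ n\<bar>)"
    unfolding H_def
    by (rule summable_fps_inverse) (use S0 sm less1 in \<open>simp_all add: S_def\<close>)
  have smS: "summable (\<lambda>n. \<bar>S $ n\<bar>)"
    using sm unfolding S_def by (subst summable_Suc_iff[symmetric]) simp
  \<comment> \<open>Absolute convergence allows the formal identity \<open>S * H = 1\<close> to be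
    evaluated at 1.\<close>
  have "(\<lambda>n. \<Sum>i\<le>n. S $ i * H $ (n - i)) sums ((\<Sum>n. S $ n) * (\<Sum>n. H $ n))"
    using smS smH by (intro Cauchy_product_sums) auto
  also have "(\<lambda>n. \<Sum>i\<le>n. S $ i * H $ (n - i)) = (\<lambda>n. (S * H) $ n)"
    by (simp add: fps_mult_nth atLeast0AtMost)
  also have "S * H = 1"
    unfolding H_def using S0 by (simp add: inverse_mult_eq_1')
  finally have "(\<lambda>n. (1 :: real fps) $ n) sums ((\<Sum>n. S $ n) * (\<Sum>n. H $ n))" .
  moreover have "(\<lambda>n. (1 :: real fps) $ n) sums 1"
    using sums_single[of 0 "\<lambda>_. 1 :: real"] by (simp add: eq_commute)
  ultimately have prod: "(\<Sum>n. S $ n) * (\<Sum>n. H $ n) = 1"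
    by (metis sums_unique2)
  \<comment> \<open>The constant term 1 dominates all the others together, so S(1) > 0.\<close>
  have "\<bar>\<Sum>n. S $ Suc n\<bar> < 1"
    using summable_rabs[of "\<lambda>n. S $ Suc n"] sm less1 by (simp add: S_def)
  moreover have "(\<Sum>n. S $ n) = 1 + (\<Sum>n. S $ Suc n)"
    using suminf_split_head[OF summable_rabs_cancel[OF smS]] S0 by simp
  ultimately have "(\<Sum>n. S $ n) > 0" by linarith
  with prod have pos: "(\<Sum>n. H $ n) > 0"
    by (metis zero_less_mult_pos zero_less_one)
  have "(\<lambda>n. \<Sum>k<Suc n. H $ k) \<longlonglongrightarrow> (\<Sum>n. H $ n)"
    by (rule LIMSEQ_Suc, rule summable_LIMSEQ, rule summable_rabs_cancel[OF smH])
  then have "(\<lambda>n. inverse f $ n * r ^ n) \<longlonglongrightarrow> (\<Sum>n. H $ n)"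
    by (simp only: D[symmetric]) (simp add: D_def)
  with pos show ?thesis by blast
qed

text \<open>Comparison with a geometric series. It serves both to certify signs from truncations and
  to bound the partial sums at the root.\<close>

lemma powser_tail_le:
  fixes a :: "nat \<Rightarrow> real"
  assumes a: "\<And>k. \<bar>a k\<bar> \<le> c" and x: "0 \<le> x" "x < 1"
  shows "summable (\<lambda>k. a k * x ^ k)"
    and "\<bar>(\<Sum>k. a k * x ^ k) - (\<Sum>k<N. a k * x ^ k)\<bar> \<le> c * x ^ N / (1 - x)"
proof -
  have geo: "(\<lambda>k. c * x ^ N * x ^ k) sums (c * x ^ N * (1 / (1 - x)))" for N
    using x by (intro sums_mult geometric_sums) simp
  have le: "\<bar>a (k + N) * x ^ (k + N)\<bar> \<le> c * x ^ N * x ^ k" for k N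
    using mult_right_mono[OF a[of "k + N"], of "x ^ (k + N)"] x
    by (simp add: abs_mult power_add mult_ac)
  have abs: "summable (\<lambda>k. \<bar>a (k + N) * x ^ (k + N)\<bar>)" for N
    by (rule summable_comparison_test'[OF sums_summable[OF geo[of N]], of 0])
       (use le[of _ N] in simp)
  show sm: "summable (\<lambda>k. a k * x ^ k)"
    using summable_rabs_cancel[OF abs[of 0]] by simp
  have "(\<Sum>k. a k * x ^ k) - (\<Sum>k<N. a k * x ^ k) = (\<Sum>k. a (k + N) * x ^ (k + N))"
    using suminf_split_initial_segment[OF sm, of N] by simp
  also have "\<bar>\<dots>\<bar> \<le> (\<Sum>k. \<bar>a (k + N) * x ^ (k + N)\<bar>)"
    by (rule summable_rabs[OF abs])
  also have "\<dots> \<le> (\<Sum>k. c * x ^ N * x ^ k)"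
    by (intro suminf_le le abs sums_summable[OF geo])
  also have "\<dots> = c * x ^ N / (1 - x)"
    using sums_unique[OF geo[of N]] by simp
  finally show "\<bar>(\<Sum>k. a k * x ^ k) - (\<Sum>k<N. a k * x ^ k)\<bar> \<le> c * x ^ N / (1 - x)" .
qed

section \<open>The exponents of the series: generalized pentagonal numbers\<close>

definition tri :: "nat \<Rightarrow> nat" where
  "tri n = n * (n + 1) div 2"

lemma tri_Suc: "tri (Suc n) = tri n + Suc n"
  by (simp add: tri_def)

lemma tri_0: "tri 0 = 0"
  by (simp add: tri_def)

lemma of_nat_tri: "int (tri n) = int n * (int n + 1) div 2"
  by (simp add: tri_def zdiv_int algebra_simps)

lemma le_tri: "n \<le> tri n"
  by (induction n) (simp_all add: tri_Suc)

text \<open>n(n-1)/2 is invariant under n -> 1-n, so one function on the naturals covers both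
  half-lines.\<close>

lemma binom2_eq_tri:
  "binom2 (int n + 1) = tri n" "binom2 (- int n) = tri n"
proof -
  have "binom2 (int n + 1) = nat (int n * (int n + 1) div 2)"
    by (simp add: binom2_def mult.commute)
  then show "binom2 (int n + 1) = tri n" by (simp flip: of_nat_tri)
  have "- int n * (- int n - 1) = int n * (int n + 1)" by (simp add: algebra_simps)
  then have "binom2 (- int n) = nat (int n * (int n + 1) div 2)"
    unfolding binom2_def by simp
  then show "binom2 (- int n) = tri n" by (simp flip: of_nat_tri)
qed

text \<open>The exponents coming from \<open>n \<ge> 0\<close> and, after \<open>n \<mapsto> -n-1\<close>, from \<open>n < 0\<close>.\<close>

definition pent1 :: "nat \<Rightarrow> nat" where
  "pent1 n = 3 * tri n - n"

definition pent2 :: "nat \<Rightarrow> nat" where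
  "pent2 n = 3 * tri n + n + 1"

lemma strict_mono_pent1: "strict_mono pent1"
proof (rule strict_monoI_Suc)
  fix n show "pent1 n < pent1 (Suc n)"
    using le_tri[of n] by (simp add: pent1_def tri_Suc)
qed

lemma strict_mono_pent2: "strict_mono pent2"
  by (rule strict_monoI_Suc) (simp add: pent2_def tri_Suc)

lemma pent1_less_pent2: "pent1 n < pent2 n"
  by (simp add: pent1_def pent2_def)

text \<open>Since \<open>e\<close> increases strictly, exponent \<open>k\<close> can only occur at
  indices below \<open>N\<close>; the coefficient of the infinite sum is therefore a finite
  sum.\<close>

lemma infsum_fps_monom_nth:
  fixes c :: "nat \<Rightarrow> 'a::comm_ring_1" and e :: "nat \<Rightarrow> nat"
  assumes e: "strict_mono e" and k: "k < e N"
  shows "(\<Sum>\<^sub>\<infinity>n. fps_const (c n) * fps_X ^ e n) $ k = (\<Sum>n<N. if e n = k then c n else 0)"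
proof -
  let ?f = "\<lambda>n. fps_const (c n) * fps_X ^ e n"
  have nth: "?f n $ j = (if e n = j then c n else 0)" for n j
    by simp
  have fin_e: "finite {n. e n = j}" for j
    using strict_mono_imp_increasing[OF e]
    by (intro finite_subset[OF _ finite_atMost[of j]]) auto
  have fin: "finite {n \<in> UNIV. ?f n $ j \<noteq> 0}" for j
    by (rule finite_subset[OF _ fin_e[of j]]) (auto simp: nth split: if_splits)
  have "(\<Sum>\<^sub>\<infinity>n. ?f n) $ k = (\<Sum>n | n \<in> UNIV \<and> ?f n $ k \<noteq> 0. ?f n $ k)"
    by (subst infsumI[OF fps_has_sum[OF fin]]) simp
  also have "\<dots> = (\<Sum>n<N. ?f n $ k)"
  proof (rule sum.mono_neutral_left)
    show "{n. n \<in> UNIV \<and> ?f n $ k \<noteq> 0} \<subseteq> {..<N}"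
      using k strict_mono_less[OF e] by (auto simp: nth split: if_splits)
  qed auto
  finally show ?thesis by (simp only: nth)
qed

lemma false_theta_eq:
  fixes x y :: "'a::comm_ring_1 fps"
  shows "false_theta x y = (\<Sum>\<^sub>\<infinity>n. x ^ tri n * y ^ (tri n - n)) - (\<Sum>\<^sub>\<infinity>n. x ^ tri n * y ^ tri (Suc n))"
proof -
  let ?f = "\<lambda>n. x ^ binom2 (n + 1) * y ^ binom2 n"
  have b1: "bij_betw int UNIV {0..}"
    by (rule bij_betwI[where g = nat]) auto
  have b2: "bij_betw (\<lambda>n. - int (Suc n)) UNIV {..<0}"
    by (rule bij_betwI[where g = "\<lambda>i. nat (- i - 1)"]) auto
  \<comment> \<open>For positive \<open>n\<close> the difference is \<open>tri (n - 1)\<close>; at 0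
    both sides vanish.\<close>
  have bn: "binom2 (int n) = tri n - n" for n
  proof (cases n)
    case (Suc m)
    then have "int n = int m + 1" by simp
    then have "binom2 (int n) = tri m" by (simp only: binom2_eq_tri)
    then show ?thesis by (simp add: Suc tri_Suc)
  qed (simp add: binom2_def tri_0)
  have e1: "?f (int n) = x ^ tri n * y ^ (tri n - n)" for n
    by (simp add: bn binom2_eq_tri)
  have e2: "?f (- int (Suc n)) = x ^ tri n * y ^ tri (Suc n)" for n
  proof -
    have "- int (Suc n) + 1 = - int n" by simp
    then show ?thesis by (simp only: binom2_eq_tri)
  qed
  show ?thesis
    unfolding false_theta_def
      infsum_reindex_bij_betw[OF b1, of ?f, symmetric] infsum_reindex_bij_betw[OF b2, of ?f, symmetric]
      e1 e2 ..
qed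

lemma false_theta_nth:
  assumes k: "k < pent1 N"
  shows "false_theta (- (fps_X ^ 2)) (fps_X :: 'a::comm_ring_1 fps) $ k
    = (\<Sum>n<N. if pent1 n = k then (- 1) ^ tri n else 0)
    - (\<Sum>n<N. if pent2 n = k then (- 1) ^ tri n else 0)"
proof -
  have pow: "(- (fps_X ^ 2)) ^ m * fps_X ^ l = fps_const ((- 1) ^ m) * (fps_X :: 'a fps) ^ (2 * m + l)" for m l
  proof -
    have "fps_const ((- 1) ^ m) = (- 1 :: 'a fps) ^ m"
      by (simp flip: fps_const_power fps_const_neg)
    then show ?thesis
      by (simp only: power_minus[of "fps_X ^ 2"] power_add power_mult mult.assoc)
  qed
  have e: "2 * tri n + (tri n - n) = pent1 n" "2 * tri n + tri (Suc n) = pent2 n" for n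
    using le_tri[of n] by (simp_all add: pent1_def pent2_def tri_Suc)
  \<comment> \<open>One cut-off \<open>N\<close> works for both families of exponents.\<close>
  from k pent1_less_pent2 have "k < pent2 N" using order.strict_trans by blast
  with k show ?thesis
    by (simp only: false_theta_eq pow e fps_sub_nth infsum_fps_monom_nth strict_mono_pent1 strict_mono_pent2)
qed

text \<open>A strictly increasing \<open>e\<close> takes the value \<open>k\<close> at most once, so
  at most one sign survives.\<close>

lemma abs_sum_signs_le:
  fixes e t :: "nat \<Rightarrow> nat"
  assumes "strict_mono e"
  shows "\<bar>\<Sum>n<N. if e n = k then (- 1) ^ t n else 0 :: real\<bar> \<le> 1"
proof -
  have "\<bar>\<Sum>n<N. if e n = k then (- 1) ^ t n else 0 :: real\<bar>
      \<le> (\<Sum>n<N. \<bar>if e n = k then (- 1) ^ t n else 0 :: real\<bar>)"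
    by (rule sum_abs)
  also have "\<dots> = (\<Sum>n<N. if e n = k then 1 else 0)"
    by (intro sum.cong) (auto simp: power_abs)
  also have "\<dots> = real (card {n \<in> {..<N}. e n = k})"
    by (simp flip: sum.inter_filter)
  also have "card {n \<in> {..<N}. e n = k} \<le> Suc 0"
    by (subst card_le_Suc0_iff_eq) (auto simp: strict_mono_eq[OF assms])
  finally show ?thesis by simp
qed

section \<open>The real coefficients, the root and the partial sums there\<close>

definition phi :: "nat \<Rightarrow> real" where
  "phi k = false_theta (- (fps_X ^ 2)) fps_X $ k"

text \<open>One sign at most from each family; this crude bound avoids showing that the families are
  disjoint.\<close>

lemma abs_phi_le: "\<bar>phi k\<bar> \<le> 2"
proof -
  have "Suc k \<le> pent1 (Suc k)"
    by (rule strict_mono_imp_increasing[OF strict_mono_pent1])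
  then have "k < pent1 (Suc k)" by simp
  then have "\<bar>phi k\<bar> = \<bar>(\<Sum>n<Suc k. if pent1 n = k then (- 1) ^ tri n else 0)
    - (\<Sum>n<Suc k. if pent2 n = k then (- 1) ^ tri n else 0)\<bar>"
    by (simp only: phi_def false_theta_nth)
  also have "\<dots> \<le> 1 + 1"
    by (intro order_trans[OF abs_triangle_ineq4] add_mono abs_sum_signs_le
          strict_mono_pent1 strict_mono_pent2)
  finally show ?thesis by simp
qed

lemma phi_eq:
  assumes "k < 40"
  shows "phi k = of_bool (k = 0) - of_bool (k = 1) - of_bool (k = 2) + of_bool (k = 5)
    - of_bool (k = 7) + of_bool (k = 12) + of_bool (k = 15) - of_bool (k = 22)
    + of_bool (k = 26) - of_bool (k = 35)"
proof -
  \<comment> \<open>All exponents below 40 come from indices \<open>n < 5\<close>, two for each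
    index.\<close>
  have "pent1 5 = 40" by (simp add: pent1_def tri_def)
  with assms have "k < pent1 5" by simp
  from false_theta_nth[OF this, where ?'a = real] show ?thesis
    unfolding phi_def[symmetric]
    by (simp add: lessThan_nat_numeral pent1_def pent2_def tri_def of_bool_def eq_commute[of _ k])
qed

text \<open>Keeping \<open>N\<close> symbolic lets one formula give both the truncation at 40 and
  the short sums near the start.\<close>

lemma sum_phi_eq:
  assumes "N \<le> 40"
  shows "(\<Sum>k<N. phi k * x ^ k) = of_bool (0 < N) - of_bool (1 < N) * x - of_bool (2 < N) * x ^ 2
    + of_bool (5 < N) * x ^ 5 - of_bool (7 < N) * x ^ 7 + of_bool (12 < N) * x ^ 12
    + of_bool (15 < N) * x ^ 15 - of_bool (22 < N) * x ^ 22 + of_bool (26 < N) * x ^ 26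
    - of_bool (35 < N) * x ^ 35"
proof -
  have delta: "(\<Sum>k<N. of_bool (k = j) * x ^ k) = of_bool (j < N) * x ^ j" for j
    by (simp add: of_bool_def if_distrib[of "\<lambda>c. c * _"] cong: if_cong)
  have "(\<Sum>k<N. phi k * x ^ k) = (\<Sum>k<N. (of_bool (k = 0) - of_bool (k = 1) - of_bool (k = 2)
      + of_bool (k = 5) - of_bool (k = 7) + of_bool (k = 12) + of_bool (k = 15)
      - of_bool (k = 22) + of_bool (k = 26) - of_bool (k = 35)) * x ^ k)"
    using assms by (intro sum.cong) (simp_all add: phi_eq)
  also have "\<dots> = of_bool (0 < N) * x ^ 0 - of_bool (1 < N) * x ^ 1 - of_bool (2 < N) * x ^ 2
    + of_bool (5 < N) * x ^ 5 - of_bool (7 < N) * x ^ 7 + of_bool (12 < N) * x ^ 12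
    + of_bool (15 < N) * x ^ 15 - of_bool (22 < N) * x ^ 22 + of_bool (26 < N) * x ^ 26
    - of_bool (35 < N) * x ^ 35"
    by (simp only: left_diff_distrib distrib_right sum.distrib sum_subtractf delta)
  finally show ?thesis by simp
qed

text \<open>
  The upper end point is within \<open>2 * 10^-6\<close> of the root, so the truncation has to be this fine.
\<close>

lemma phi_root:
  obtains r where "6509 / 10000 < r" "r < 100000 / 153623" "(\<Sum>k. phi k * r ^ k) = 0"
proof -
  define F where "F x = (\<Sum>k. phi k * x ^ k)" for x
  \<comment> \<open>\<open>?b\<close> is 1/1.53623. \<open>?a\<close> lies much closer to the root
    than 1/1.54522, because the later estimates need \<open>r\<close> to about three digits.\<close>
  let ?a = "6509 / 10000 :: real" and ?b = "100000 / 153623 :: real"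
  have tail: "\<bar>F x - (\<Sum>k<40. phi k * x ^ k)\<bar> \<le> 2 * x ^ 40 / (1 - x)" if "0 \<le> x" "x < 1" for x
    unfolding F_def by (rule powser_tail_le(2)[OF abs_phi_le that])
  have "(\<Sum>k<40. phi k * ?a ^ k) - 2 * ?a ^ 40 / (1 - ?a) > 0"
    unfolding sum_phi_eq[OF order.refl] by (simp add: power_divide)
  with tail[of ?a] have Fa: "F ?a > 0" by linarith
  have "(\<Sum>k<40. phi k * ?b ^ k) + 2 * ?b ^ 40 / (1 - ?b) < 0"
    unfolding sum_phi_eq[OF order.refl] by (simp add: power_divide)
  with tail[of ?b] have Fb: "F ?b < 0" by linarith
  have cont: "isCont F x" if "?a \<le> x" "x \<le> ?b" for x
    unfolding F_def
    \<comment> \<open>Any radius between \<open>?b\<close> and 1 would do: the bounded coefficients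
      give convergence there.\<close>
    by (rule isCont_powser[where K = "9 / 10"])
       (use that powser_tail_le(1)[OF abs_phi_le] in auto)
  obtain r where r: "?a \<le> r" "r \<le> ?b" "F r = 0"
    using IVT2[of F ?b 0 ?a] Fa Fb cont by auto
  with Fa Fb have "r \<noteq> ?a" "r \<noteq> ?b" by (metis less_irrefl)+
  with r show ?thesis by (intro that[of r]) (auto simp: F_def)
qed

text \<open>At a root, each partial sum is minus the remaining tail and so decays geometrically. The
  first eleven sums contribute at most 0.85, all later ones at most 0.1.\<close>

lemma phi_partial_sums_small:
  fixes r :: real
  defines "s \<equiv> \<lambda>n. \<Sum>k\<le>n. phi k * r ^ k"
  assumes r: "6509 / 10000 < r" "r < 100000 / 153623" and root: "(\<Sum>k. phi k * r ^ k) = 0"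
  shows "summable (\<lambda>n. \<bar>s (Suc n)\<bar>)" and "(\<Sum>n. \<bar>s (Suc n)\<bar>) < 1"
proof -
  have r0: "0 < r" "r < 651 / 1000" using r by simp_all
  \<comment> \<open>The first sum left to the tail is \<open>s 12\<close>, whose omitted terms begin
    at \<open>r ^ 13\<close>.\<close>
  define q where "q = 2 * r ^ 13 / (1 - r)"
  have s_le: "\<bar>s n\<bar> \<le> 2 * r ^ Suc n / (1 - r)" for n
    using powser_tail_le(2)[where a = phi and c = 2 and x = r and N = "Suc n"] abs_phi_le r0 root
    by (simp add: s_def lessThan_Suc_atMost del: power_Suc)
  have tail: "\<bar>s (Suc (n + 11))\<bar> \<le> q * r ^ n" for n
  proof -
    have "r ^ Suc (Suc (n + 11)) = r ^ 13 * r ^ n"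
      by (simp flip: power_add)
    with s_le[of "Suc (n + 11)"] show ?thesis by (simp only: q_def) simp
  qed
  have geo: "(\<lambda>n. q * r ^ n) sums (q * (1 / (1 - r)))"
    using r0 by (intro sums_mult geometric_sums) simp
  have "summable (\<lambda>n. \<bar>s (Suc (n + 11))\<bar>)"
    by (rule summable_comparison_test'[OF sums_summable[OF geo], of 0]) (use tail in simp)
  then show sm: "summable (\<lambda>n. \<bar>s (Suc n)\<bar>)"
    using summable_iff_shift[of "\<lambda>n. \<bar>s (Suc n)\<bar>" 11] by simp
  have "(\<Sum>n. \<bar>s (Suc n)\<bar>) = (\<Sum>n. \<bar>s (Suc (n + 11))\<bar>) + (\<Sum>n<11. \<bar>s (Suc n)\<bar>)"
    using suminf_split_initial_segment[OF sm, of 11] by simp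
  also have "(\<Sum>n. \<bar>s (Suc (n + 11))\<bar>) \<le> q * (1 / (1 - r))"
    using suminf_le[OF tail _ sums_summable[OF geo]] sm sums_unique[OF geo]
      summable_iff_shift[of "\<lambda>n. \<bar>s (Suc n)\<bar>" 11] by simp
  also have "\<dots> \<le> 1 / 10"
  proof -
    \<comment> \<open>The claim is 2 r^13 \<le> (1-r)^2 / 10; the left side increases and the right
      side decreases in \<open>r\<close>, so 0.651 is the worst case.\<close>
    have "2 * r ^ 13 \<le> 2 * (651 / 1000) ^ 13"
      using r0 by (intro mult_left_mono power_mono) auto
    also have "\<dots> \<le> 1 / 10 * (349 / 1000) ^ 2" by (simp add: power_divide)
    also have "\<dots> \<le> 1 / 10 * (1 - r) ^ 2"
      using r0 by (intro mult_left_mono power_mono) auto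
    finally show ?thesis using r0 by (simp add: q_def divide_simps power2_eq_square)
  qed
  also have "(\<Sum>n<11. \<bar>s (Suc n)\<bar>) \<le> 85 / 100"
  proof -
    have s: "s n = (\<Sum>k<Suc n. phi k * r ^ k)" for n
      by (simp add: s_def lessThan_Suc_atMost)
    have lo: "(6509 / 10000) ^ m \<le> r ^ m" and hi: "r ^ m \<le> (651 / 1000) ^ m" for m
      using r r0 by (intro power_mono; simp)+
    \<comment> \<open>Rational enclosures of the powers leave only linear arithmetic.\<close>
    have bounds: "42 / 100 \<le> r ^ 2" "r ^ 2 \<le> 43 / 100" "116 / 1000 \<le> r ^ 5" "r ^ 5 \<le> 117 / 1000"
      "49 / 1000 \<le> r ^ 7" "r ^ 7 \<le> 50 / 1000"
      by (rule order_trans[OF _ lo] order_trans[OF hi], simp add: power_divide)+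
    \<comment> \<open>The partial sums change only at the exponents 1, 2, 5 and 7; the next exponent
      is 12.\<close>
    have "s 1 = 1 - r" "s 2 = 1 - r - r ^ 2" "s 3 = s 2" "s 4 = s 2"
      "s 5 = s 2 + r ^ 5" "s 6 = s 5"
      "s 7 = s 5 - r ^ 7" "s 8 = s 7" "s 9 = s 7" "s 10 = s 7" "s 11 = s 7"
      by (simp_all add: s sum_phi_eq del: sum.lessThan_Suc)
    moreover from this bounds r have "\<bar>s 1\<bar> \<le> 35 / 100" "\<bar>s 2\<bar> \<le> 85 / 1000"
      "\<bar>s 5\<bar> \<le> 5 / 100" "\<bar>s 7\<bar> \<le> 2 / 100"
      by linarith+
    ultimately have "\<bar>s 1\<bar> + \<bar>s 2\<bar> + \<bar>s 3\<bar> + \<bar>s 4\<bar> + \<bar>s 5\<bar> + \<bar>s 6\<bar> + \<bar>s 7\<bar> + \<bar>s 8\<bar> + \<bar>s 9\<bar>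
        + \<bar>s 10\<bar> + \<bar>s 11\<bar> \<le> 85 / 100"
      by simp
    moreover have "s (Suc (Suc 0)) = s 2" by (simp only: numeral_2_eq_2)
    ultimately show ?thesis
      by (simp add: lessThan_nat_numeral)
  qed
  finally show "(\<Sum>n. \<bar>s (Suc n)\<bar>) < 1" by simp
qed

theorem theorem4:
  shows "\<exists>b C :: real. 1.53623 < b \<and> b < 1.54522 \<and> C > 0
           \<and> c2 \<sim>[at_top] (\<lambda>n. C * b ^ n)"
proof -
  let ?f = "false_theta (- (fps_X ^ 2)) fps_X :: real fps"
  obtain r where r: "6509 / 10000 < r" "r < 100000 / 153623" "(\<Sum>k. phi k * r ^ k) = 0"
    by (rule phi_root)
  have f0: "?f $ 0 = 1"
    using phi_eq[of 0] by (simp add: phi_def)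
  obtain C where C: "C > 0" "(\<lambda>n. inverse ?f $ n * r ^ n) \<longlonglongrightarrow> C"
    using fps_inverse_nth_asymp[of ?f r] f0 phi_partial_sums_small[OF r]
    unfolding phi_def by blast
  have "c2 n = inverse ?f $ n" for n
    using f0 by (simp add: c2_def fps_divide_unit)
  then have "(\<lambda>n. c2 n * r ^ n / C) \<longlonglongrightarrow> C / C"
    using tendsto_divide[OF C(2) tendsto_const[of C]] C(1) by simp
  moreover have "c2 n * r ^ n / C = c2 n / (C * (1 / r) ^ n)" for n
    by (simp add: power_divide)
  ultimately have "c2 \<sim>[at_top] (\<lambda>n. C * (1 / r) ^ n)"
    using C(1) by (intro asymp_equivI') simp
  \<comment> \<open>The upper bound on \<open>r\<close> is exactly the lower bound on the base; the
    bound 1.54522 holds with room to spare.\<close>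
  moreover have "1.53623 < 1 / r" "1 / r < 1.54522"
    using r(1,2) by (simp_all add: field_simps)
  ultimately show ?thesis using C(1) by blast
qed

end
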